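(* Let $\mathcal C$ be a binary linear block code of length $n$ used with BPSK over an AWGN channel with noise variance $\sigma^2>0$ per component, and let $T_u$ be an upper-bounding technique. Then the word-error probability under maximum-likelihood decoding satisfies $$\Pr\{E\}\le\min_{0\le d^*\le n}\Big\{T_u(\mathcal C_{2d^*})+B(p_b,n,d^*+1,n)\Big\}.$$ Moreover, the right-hand side is strictly less than $1$ and is at most $T_u(\mathcal C)$.
   Context: Channel and decoder: codewords are mapped by $\phi:\mathbb F_2^n\to\{-1,+1\}^n$, $\phi(\underline v)_t=1-2v_t$. The all-zero codeword $\underline c^{(0)}$ is transmitted (by symmetry the error probability does not depend on the transmitted codeword); the received vector is $\underline y=\phi(\underline c^{(0)})+\underline z$, with $\underline z$ having i.i.d. $\mathcal N(0,\sigma^2)$ components. Maximum-likelihood (ML) decoding outputs the codeword whose image under $\phi$ is nearest to $\underline y$ in Euclidean distance; $E$ is the event that the output differs from $\underline c^{(0)}$. For $d\ge1$, $E_d$ is the event that some codeword of Hamming weight $d$ has its image under $\phi$ nearer to $\underline y$ than $\phi(\underline c^{(0)})$. Sub-codes: for $t\ge0$, $\mathcal C_t=\{\underline c\in\mathcal C: W_H(\underline c)\le t\}$, where $W_H$ is Hamming weight; in particular $\mathcal C_0=\{\underline c^{(0)}\}$ and $\mathcal C_t=\mathcal C$ for $t\ge n$. Upper-bounding technique: $T_u$ assigns to each sub-code $\mathcal C_t$ a real number $T_u(\mathcal C_t)$, depending only on $\mathcal C_t$ (for the given $\sigma$), such that $\Pr\{\bigcup_{1\le d\le t}E_d\}\le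 T_u(\mathcal C_t)$, with $T_u(\mathcal C_0)=0$. Notation: $Q(x)=\int_x^{\infty}\frac1{\sqrt{2\pi}}e^{-z^2/2}\,dz$; $p_b=Q(1/\sigma)$; $B(p,N_t,N_\ell,N_u)=\sum_{m=N_\ell}^{N_u}\binom{N_t}{m}p^m(1-p)^{N_t-m}$, with empty sums equal to $0$. *)

theory Defs
  imports "HOL-Probability.Probability" "HOL-Library.Z2"
begin

text \<open>
  Words of length \<open>n = CARD('n)\<close> over \<open>\<bbbF>\<^sub>2\<close> are elements of \<open>bit ^ 'n\<close>; a binary linear code is a set
  \<open>C\<close> with \<open>vec.subspace C\<close>.
\<close>

definition hamming_weight :: "bit ^ 'n \<Rightarrow> nat"
  where "hamming_weight c = card {t. c $ t \<noteq> 0}"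

definition bpsk :: "bit ^ 'n \<Rightarrow> real ^ 'n"
  where "bpsk v = (\<chi> t. 1 - 2 * of_bool (v $ t = 1))"

definition subcode :: "(bit ^ 'n) set \<Rightarrow> nat \<Rightarrow> (bit ^ 'n) set"
  where "subcode C t = {c \<in> C. hamming_weight c \<le> t}"

definition awgn_noise :: "'a measure \<Rightarrow> real \<Rightarrow> ('n \<Rightarrow> 'a \<Rightarrow> real) \<Rightarrow> bool"
  where "awgn_noise M \<sigma> z \<longleftrightarrow>
    prob_space M \<and>
    prob_space.indep_vars M (\<lambda>_. borel) z UNIV \<and>
    (\<forall>t. distributed M lborel (z t) (normal_density 0 \<sigma>))"

text \<open>The all-zero codeword is transmitted.\<close>

definition received :: "('n::finite \<Rightarrow> 'a \<Rightarrow> real) \<Rightarrow> 'a \<Rightarrow> real ^ 'n"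
  where "received z \<omega> = bpsk 0 + (\<chi> t. z t \<omega>)"

text \<open>Ties may be broken arbitrarily, subject to measurability of the decision.\<close>

definition ml_decoder :: "(bit ^ 'n) set \<Rightarrow> (real ^ 'n \<Rightarrow> bit ^ 'n) \<Rightarrow> bool"
  where "ml_decoder C dec \<longleftrightarrow>
    dec \<in> borel \<rightarrow>\<^sub>M count_space UNIV \<and>
    (\<forall>y. is_arg_min (\<lambda>c. dist (bpsk c) y) (\<lambda>c. c \<in> C) (dec y))"

definition error_event ::
    "'a measure \<Rightarrow> ('n::finite \<Rightarrow> 'a \<Rightarrow> real) \<Rightarrow> (real ^ 'n \<Rightarrow> bit ^ 'n) \<Rightarrow> 'a set"
  where "error_event M z dec = {\<omega> \<in> space M. dec (received z \<omega>) \<noteq> 0}"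

definition weight_event ::
    "'a measure \<Rightarrow> ('n::finite \<Rightarrow> 'a \<Rightarrow> real) \<Rightarrow> (bit ^ 'n) set \<Rightarrow> nat \<Rightarrow> 'a set"
  where "weight_event M z C d =
    {\<omega> \<in> space M. \<exists>c\<in>C. hamming_weight c = d \<and>
      dist (bpsk c) (received z \<omega>) < dist (bpsk 0) (received z \<omega>)}"

text \<open>
  A bounding technique is a function of the sub-code as a set, so that equal sub-codes
  receive equal bounds.
\<close>

definition upper_bounding_technique ::
    "'a measure \<Rightarrow> ('n::finite \<Rightarrow> 'a \<Rightarrow> real) \<Rightarrow> (bit ^ 'n) set \<Rightarrow> ((bit ^ 'n) set \<Rightarrow> real) \<Rightarrow> bool"
  where "upper_bounding_technique M z C T \<longleftrightarrow>
    T (subcode C 0) = 0 \<and>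
    (\<forall>t. measure M (\<Union>d\<in>{1..t}. weight_event M z C d) \<le> T (subcode C t))"

definition Q :: "real \<Rightarrow> real"
  where "Q x = (LBINT z:{x..}. 1 / sqrt (2 * pi) * exp (- (z\<^sup>2) / 2))"

definition B :: "real \<Rightarrow> nat \<Rightarrow> nat \<Rightarrow> nat \<Rightarrow> real"
  where "B p Nt Nl Nu = (\<Sum>m=Nl..Nu. real (Nt choose m) * p ^ m * (1 - p) ^ (Nt - m))"

end

(* ML decoding is compared with a list decoder that considers only the codewords within Hamming
   distance d of the hard decision on y. If 0 is transmitted, the list decoder fails only if there
   are more than d hard errors (the binomial tail) or a codeword of weight at most 2d is nearer to y
   than 0 (the term bounded by T). It remains to see that ML decoding is at least as good, given that
   0 is transmitted. Coordinatewise sign changes by bpsk c, for c in C, preserve Lebesgue measure and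
   permute the codeword images. Averaging the success probability over them gives the integral of the
   sum of f (flip c x) over those c with flip c x in the success region. For almost every x at most
   one c contributes in the case of the list decoder, whereas ML decoding contributes the term
   c = dec x, which is the largest because f decreases with the distance from bpsk 0.
   The value d = 0 gives a right-hand side 1 - (1 - p)^n < 1, and d = n gives T C. *)
theory Submission
  imports Defs
begin

section \<open>Lebesgue measure and joint densities on \<open>real ^ 'n\<close> in
  coordinates\<close>

lemma vec_lambda_borel_measurable [measurable (raw)]:
  fixes f :: "'a \<Rightarrow> 'n::finite \<Rightarrow> real"
  assumes "\<And>t. (\<lambda>x. f x t) \<in> borel_measurable M"
  shows "(\<lambda>x. \<chi> t. f x t) \<in> borel_measurable M"
  using assms by (subst borel_measurable_euclidean_space) (auto simp: Basis_vec_def inner_axis)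

lemma vec_nth_borel_measurable [measurable (raw)]:
  fixes f :: "'a \<Rightarrow> real ^ 'n"
  assumes "f \<in> borel_measurable M"
  shows "(\<lambda>x. f x $ t) \<in> borel_measurable M"
  using borel_measurable_inner[OF assms borel_measurable_const[of "axis t 1"]]
  by (simp add: inner_axis)

lemma prod_Basis_cart:
  fixes f :: "real ^ 'n \<Rightarrow> 'a::comm_monoid_mult"
  shows "(\<Prod>b\<in>Basis. f b) = (\<Prod>t\<in>UNIV. f (axis t 1))"
proof -
  have "Basis = (\<lambda>t. axis t (1::real)) ` (UNIV :: 'n set)"
    by (auto simp: Basis_vec_def)
  moreover have "inj (\<lambda>t::'n. axis t (1::real))"
    by (auto simp: inj_def axis_eq_axis)
  ultimately show ?thesis
    by (metis (no_types, lifting) prod.reindex_cong)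
qed

text \<open>\<open>lborel\<close> on \<open>real ^ 'n\<close> is built from \<open>Basis\<close>,
  whereas independence is expressed with \<open>PiM\<close>. Both sides give an open box the product
  of its side lengths, which determines the measure.\<close>

lemma distr_PiM_lborel_vec:
  "distr (\<Pi>\<^sub>M t\<in>UNIV. lborel) borel vec_lambda = (lborel :: (real ^ 'n) measure)"
proof (rule lborel_eqI[symmetric])
  interpret product_sigma_finite "\<lambda>_::'n. lborel :: real measure"
    by (simp add: product_sigma_finite_def sigma_finite_lborel)
  fix l u :: "real ^ 'n"
  assume "\<And>b. b \<in> Basis \<Longrightarrow> l \<bullet> b \<le> u \<bullet> b"
  then have le: "l $ t \<le> u $ t" for t
    by (metis axis_in_Basis_iff cart_eq_inner_axis Basis_real_def singletonI)
  have meas: "vec_lambda \<in> (\<Pi>\<^sub>M t\<in>(UNIV :: 'n set). lborel) \<rightarrow>\<^sub>M (borel :: (real ^ 'n) measure)"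
    using vec_lambda_borel_measurable[of "\<lambda>x. x" "\<Pi>\<^sub>M t\<in>(UNIV :: 'n set). lborel"] by simp
  have "vec_lambda -` box l u \<inter> space (\<Pi>\<^sub>M t\<in>UNIV. lborel) = (\<Pi>\<^sub>E t\<in>UNIV. {l $ t<..<u $ t})"
    by (auto simp: mem_box_cart space_PiM PiE_iff)
  then have "emeasure (distr (\<Pi>\<^sub>M t\<in>UNIV. lborel) borel vec_lambda) (box l u)
      = (\<Prod>t\<in>UNIV. ennreal (u $ t - l $ t))"
    using le by (simp add: emeasure_distr[OF meas] emeasure_PiM)
  also have "\<dots> = ennreal (\<Prod>b\<in>Basis. (u - l) \<bullet> b)"
    using le by (simp add: prod_Basis_cart prod_ennreal inner_axis)
  finally show "emeasure (distr (\<Pi>\<^sub>M t\<in>UNIV. lborel) borel vec_lambda) (box l u)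
      = ennreal (\<Prod>b\<in>Basis. (u - l) \<bullet> b)" .
qed simp

text \<open>Independence makes the joint law a product of laws, the densities multiply, and
  \<open>vec_lambda\<close> carries the result over to \<open>real ^ 'n\<close>.\<close>

lemma (in prob_space) distr_vec_density:
  fixes X :: "'n::finite \<Rightarrow> 'a \<Rightarrow> real" and f :: "'n \<Rightarrow> real \<Rightarrow> ennreal"
  assumes indep: "indep_vars (\<lambda>_. borel) X UNIV"
    and dens: "\<And>t. distributed M lborel (X t) (f t)"
  shows "distr M borel (\<lambda>\<omega>. \<chi> t. X t \<omega>) = density lborel (\<lambda>y. \<Prod>t\<in>UNIV. f t (y $ t))"
proof -
  let ?L = "\<Pi>\<^sub>M t\<in>(UNIV :: 'n set). (lborel :: real measure)"
  have X [measurable]: "X t \<in> borel_measurable M" for t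
    using distributed_measurable[OF dens[of t]] by simp
  have f [measurable]: "f t \<in> borel_measurable borel" for t
    using distributed_borel_measurable[OF dens[of t]] by simp
  have distr_X: "distr M borel (X t) = density lborel (f t)" for t
    using dens[of t] unfolding distributed_def by (auto cong: distr_cong)
  interpret L: product_sigma_finite "\<lambda>_::'n. lborel :: real measure"
    by (simp add: product_sigma_finite_def sigma_finite_lborel)
  \<comment> \<open>The factors are the laws of the \<open>X t\<close>, hence probability measures;
    this supplies the sigma-finiteness behind \<open>D.PiM_eqI\<close>.\<close>
  have "prob_space (density lborel (f t))" for t
    unfolding distr_X[symmetric] by (rule prob_space_distr) simp
  then interpret D: product_sigma_finite "\<lambda>t. density lborel (f t)"
    by (simp add: product_sigma_finite_def prob_space_imp_sigma_finite)
  have "distr M (\<Pi>\<^sub>M t\<in>UNIV. borel) (\<lambda>\<omega> t. X t \<omega>) = (\<Pi>\<^sub>M t\<in>UNIV. distr M borel (X t))"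
    using indep_vars_iff_distr_eq_PiM[where I = UNIV and X = X and M' = "\<lambda>_. borel"] indep by (simp add: restrict_UNIV)
  also have "\<dots> = (\<Pi>\<^sub>M t\<in>UNIV. density lborel (f t))"
    by (simp add: distr_X)
  also have "\<dots> = density ?L (\<lambda>x. \<Prod>t\<in>UNIV. f t (x t))"
  proof (rule D.PiM_eqI[symmetric])
    show "sets (density ?L (\<lambda>x. \<Prod>t\<in>UNIV. f t (x t))) = sets (\<Pi>\<^sub>M t\<in>UNIV. density lborel (f t))"
      by (auto intro!: sets_PiM_cong)
    fix A :: "'n \<Rightarrow> real set"
    assume "\<And>t. t \<in> UNIV \<Longrightarrow> A t \<in> sets (density lborel (f t))"
    then have A [measurable]: "A t \<in> sets borel" for t
      by simp
    have "emeasure (density ?L (\<lambda>x. \<Prod>t\<in>UNIV. f t (x t))) (Pi\<^sub>E UNIV A)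
        = (\<integral>\<^sup>+x. (\<Prod>t\<in>UNIV. f t (x t)) * indicator (Pi\<^sub>E UNIV A) x \<partial>?L)"
      by (intro emeasure_density) (auto intro!: sets_PiM_I_finite)
    also have "\<dots> = (\<integral>\<^sup>+x. (\<Prod>t\<in>UNIV. f t (x t) * indicator (A t) (x t)) \<partial>?L)"
      by (intro nn_integral_cong) (auto simp: indicator_def prod.distrib PiE_iff)
    also have "\<dots> = (\<Prod>t\<in>UNIV. \<integral>\<^sup>+x. f t x * indicator (A t) x \<partial>lborel)"
      by (intro L.product_nn_integral_prod) auto
    also have "\<dots> = (\<Prod>t\<in>UNIV. emeasure (density lborel (f t)) (A t))"
      by (simp add: emeasure_density)
    finally show "emeasure (density ?L (\<lambda>x. \<Prod>t\<in>UNIV. f t (x t))) (Pi\<^sub>E UNIV A)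
        = (\<Prod>t\<in>UNIV. emeasure (density lborel (f t)) (A t))" .
  qed simp
  finally have joint: "distr M (\<Pi>\<^sub>M t\<in>UNIV. borel) (\<lambda>\<omega> t. X t \<omega>)
      = density ?L (\<lambda>x. \<Prod>t\<in>UNIV. f t (x t))" .
  have vec [measurable]: "vec_lambda \<in> (\<Pi>\<^sub>M t\<in>(UNIV :: 'n set). borel) \<rightarrow>\<^sub>M (borel :: (real ^ 'n) measure)"
    using vec_lambda_borel_measurable[of "\<lambda>x. x" "\<Pi>\<^sub>M t\<in>(UNIV :: 'n set). borel"] by simp
  have vec' [measurable]: "vec_lambda \<in> ?L \<rightarrow>\<^sub>M (borel :: (real ^ 'n) measure)"
    using vec_lambda_borel_measurable[of "\<lambda>x. x" ?L] by simp
  have "distr M borel (\<lambda>\<omega>. \<chi> t. X t \<omega>)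
      = distr (distr M (\<Pi>\<^sub>M t\<in>UNIV. borel) (\<lambda>\<omega> t. X t \<omega>)) borel vec_lambda"
    by (subst distr_distr) (auto simp: comp_def intro!: measurable_PiM_single')
  \<comment> \<open>Here \<open>x t\<close> is written as \<open>vec_lambda x $ t\<close>, so that
    the density factors through \<open>vec_lambda\<close> and \<open>density_distr\<close>
    applies.\<close>
  also have "\<dots> = distr (density ?L (\<lambda>x. \<Prod>t\<in>UNIV. f t (vec_lambda x $ t))) borel vec_lambda"
    by (simp add: joint)
  also have "\<dots> = density (distr ?L borel vec_lambda) (\<lambda>y. \<Prod>t\<in>UNIV. f t (y $ t))"
    by (rule density_distr[symmetric]) auto
  finally show ?thesis
    by (simp add: distr_PiM_lborel_vec)
qed

text \<open>Squared deviations add up to the squared Euclidean distance. Hence the likelihood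
  decreases with the distance from \<open>\<mu>\<close>, which is what \<open>ml_optimal\<close>
  asks of the density.\<close>

lemma prod_normal_density_cart:
  fixes y \<mu> :: "real ^ 'n"
  assumes "\<sigma> > 0"
  shows "(\<Prod>t\<in>UNIV. normal_density (\<mu> $ t) \<sigma> (y $ t))
    = (1 / sqrt (2 * pi * \<sigma>\<^sup>2)) ^ CARD('n) * exp (- (dist \<mu> y)\<^sup>2 / (2 * \<sigma>\<^sup>2))"
proof -
  have "(dist \<mu> y)\<^sup>2 = (\<Sum>t\<in>UNIV. (y $ t - \<mu> $ t)\<^sup>2)"
    by (simp add: dist_vec_def L2_set_def sum_nonneg dist_real_def power2_commute)
  then have "- (dist \<mu> y)\<^sup>2 / (2 * \<sigma>\<^sup>2) = (\<Sum>t\<in>UNIV. - (y $ t - \<mu> $ t)\<^sup>2 / (2 * \<sigma>\<^sup>2))"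
    by (simp add: sum_negf sum_divide_distrib)
  then show ?thesis
    by (simp add: normal_density_def prod_dividef power_one_over exp_sum)
qed

section \<open>Sign changes by words, and ties\<close>

text \<open>\<open>bpsk\<close> turns addition into coordinatewise multiplication, so
  \<open>flip c\<close> takes \<open>bpsk c'\<close> to \<open>bpsk (c + c')\<close>: translation by
  \<open>c\<close> becomes an isometry of \<open>real ^ 'n\<close>.\<close>

definition flip :: "bit ^ 'n \<Rightarrow> real ^ 'n \<Rightarrow> real ^ 'n::finite"
  where "flip c x = (\<chi> t. bpsk c $ t * x $ t)"

lemma flip_measurable [measurable]: "flip c \<in> borel_measurable borel"
  unfolding flip_def by measurable

text \<open>A diagonal map with entries 1 and -1 has a determinant of absolute value 1.\<close>

lemma distr_lborel_flip: "distr lborel borel (flip c) = (lborel :: (real ^ 'n) measure)"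
proof -
  \<comment> \<open>\<open>lborel_affine_euclidean\<close> indexes the diagonal entries by basis
    vectors; the inner product reads off the sign.\<close>
  define a :: "real ^ 'n \<Rightarrow> real" where "a b = bpsk c \<bullet> b" for b
  have basis: "b \<in> Basis \<Longrightarrow> \<bar>a b\<bar> = 1" for b
    by (auto simp: a_def bpsk_def Basis_vec_def inner_axis of_bool_def)
  have "0 + (\<Sum>j\<in>Basis. (a j * (x \<bullet> j)) *\<^sub>R j) = flip c x" for x
  proof (rule euclidean_eqI)
    fix b :: "real ^ 'n" assume b: "b \<in> Basis"
    then have "(0 + (\<Sum>j\<in>Basis. (a j * (x \<bullet> j)) *\<^sub>R j)) \<bullet> b = a b * (x \<bullet> b)"
      by simp
    also have "\<dots> = flip c x \<bullet> b"
      using b by (auto simp: a_def flip_def Basis_vec_def inner_axis)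
    finally show "(0 + (\<Sum>j\<in>Basis. (a j * (x \<bullet> j)) *\<^sub>R j)) \<bullet> b = flip c x \<bullet> b" .
  qed
  then have "lborel = density (distr lborel borel (flip c)) (\<lambda>_. (\<Prod>j\<in>Basis. \<bar>a j\<bar>))"
    using lborel_affine_euclidean[of a 0] basis by force
  then show ?thesis
    by (simp add: basis density_1)
qed

lemma dist_bpsk_flip: "dist (bpsk c') (flip c x) = dist (bpsk (c + c')) x"
proof -
  have "(bpsk c' $ t - bpsk c $ t * x $ t)\<^sup>2 = (bpsk (c + c') $ t - x $ t)\<^sup>2" for t
    by (cases "c $ t"; cases "c' $ t") (auto simp: bpsk_def power2_eq_square algebra_simps)
  then show ?thesis
    by (simp add: dist_vec_def L2_set_def dist_real_def flip_def)
qed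

text \<open>Makes \<open>bit ^ 'n\<close> a finite type, so that almost-everywhere statements can
  range over all words and sums over \<open>C\<close> are finite.\<close>

instance bit :: finite
proof
  have "UNIV = {0, 1 :: bit}"
    by (auto intro: bit.exhaust)
  then show "finite (UNIV :: bit set)"
    by (metis finite.emptyI finite.insertI)
qed

text \<open>All words have images of the same norm, so the points equidistant from two of them form
  a hyperplane through the origin, a null set. There are finitely many pairs.\<close>

lemma AE_inj_dist_bpsk: "AE x in lborel. inj (\<lambda>c. dist (bpsk c) (x :: real ^ 'n))"
proof -
  have *: "AE x in lborel. dist (bpsk c) x = dist (bpsk c') (x :: real ^ 'n) \<longrightarrow> c = c'" for c c' :: "bit ^ 'n"
  proof (cases "c = c'")
    case False
    then obtain t where "c $ t \<noteq> c' $ t"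
      by (auto simp: vec_eq_iff)
    then have "bpsk c $ t \<noteq> bpsk c' $ t"
      by (cases "c $ t"; cases "c' $ t") (auto simp: bpsk_def)
    then have ne: "bpsk c - bpsk c' \<noteq> 0"
      by (auto simp: vec_eq_iff)
    have "norm (bpsk c) = norm (bpsk c')"
      by (auto simp: norm_vec_def L2_set_def bpsk_def of_bool_def intro!: sum.cong)
    then have eq: "{x. dist (bpsk c) x = dist (bpsk c') x} = {x. (bpsk c - bpsk c') \<bullet> x = 0}"
      by (auto simp: dist_norm norm_eq_sqrt_inner inner_diff inner_commute algebra_simps)
    have "{x. dist (bpsk c) x = dist (bpsk c') x} \<in> null_sets lebesgue"
      unfolding eq negligible_iff_null_sets[symmetric] using ne by (intro negligible_hyperplane) auto
    \<comment> \<open>Negligibility concerns the completed measure; a Borel set that is null there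
      is null for \<open>lborel\<close> too.\<close>
    moreover have "{x. dist (bpsk c) x = dist (bpsk c') x} \<in> sets borel"
      by measurable
    ultimately have "{x. dist (bpsk c) x = dist (bpsk c') x} \<in> null_sets lborel"
      by (auto simp: null_sets_def)
    then show ?thesis
      using False by (intro AE_I'[where N = "{x. dist (bpsk c) x = dist (bpsk c') x}"]) auto
  qed simp
  show ?thesis
    unfolding inj_def by (intro eventually_all_finite *)
qed

section \<open>Binomial and Gaussian tails\<close>

text \<open>The event is split by the exact set \<open>J\<close> of indices that hit
  \<open>A\<close>. Independence gives each piece a probability depending only on
  \<open>card J\<close>, and the pieces are then grouped by cardinality.\<close>

lemma (in prob_space) prob_card_eq_binomial_tail:
  fixes X :: "'n::finite \<Rightarrow> 'a \<Rightarrow> 'b"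
  assumes indep: "indep_vars (\<lambda>_. N) X UNIV" and A: "A \<in> sets N"
    and p: "\<And>t. prob {\<omega> \<in> space M. X t \<omega> \<in> A} = p"
  shows "prob {\<omega> \<in> space M. d < card {t. X t \<omega> \<in> A}} = B p CARD('n) (d + 1) CARD('n)"
proof -
  define F where "F J = {\<omega> \<in> space M. {t. X t \<omega> \<in> A} = J}" for J
  have X: "X t \<in> M \<rightarrow>\<^sub>M N" for t
    using indep by (auto simp: indep_vars_def)
  have hit: "{\<omega> \<in> space M. X t \<omega> \<in> A} \<in> events" for t
    using measurable_sets[OF X A] by (simp add: vimage_def Int_def conj_commute)
  have F_eq: "F J = (\<Inter>t\<in>UNIV. X t -` (if t \<in> J then A else space N - A) \<inter> space M)" for J
    using measurable_space[OF X] by (auto simp: F_def split: if_splits)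
  have F_events [measurable]: "F J \<in> events" for J
    unfolding F_eq using A X by (intro sets.finite_INT measurable_sets[OF X]) auto
  have hit_prob: "prob (X t -` (if t \<in> J then A else space N - A) \<inter> space M) = (if t \<in> J then p else 1 - p)"
    for t J
  proof (cases "t \<in> J")
    case True
    then show ?thesis
      using p[of t] by (simp add: vimage_def Int_def conj_commute)
  next
    case False
    have "X t -` (space N - A) \<inter> space M = space M - {\<omega> \<in> space M. X t \<omega> \<in> A}"
      using measurable_space[OF X] by auto
    with False show ?thesis
      using prob_compl[OF hit[of t]] p[of t] by simp
  qed
  have F_prob: "prob (F J) = p ^ card J * (1 - p) ^ (CARD('n) - card J)" for J :: "'n set"
  proof -
    have "prob (F J) = (\<Prod>t\<in>UNIV. prob (X t -` (if t \<in> J then A else space N - A) \<inter> space M))"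
      unfolding F_eq using A by (intro indep_varsD_finite[OF indep]) auto
    also have "\<dots> = (\<Prod>t\<in>UNIV. if t \<in> J then p else 1 - p)"
      by (simp add: hit_prob)
    also have "\<dots> = p ^ card J * (1 - p) ^ card (- J)"
      by (simp add: prod.If_cases)
    finally show ?thesis
      by (simp add: Compl_eq_Diff_UNIV card_Diff_subset)
  qed
  have "{\<omega> \<in> space M. d < card {t. X t \<omega> \<in> A}} = (\<Union>J\<in>{J. d < card J}. F J)"
    by (auto simp: F_def)
  also have "prob \<dots> = (\<Sum>J\<in>{J. d < card J}. prob (F J))"
    using F_events by (intro finite_measure_finite_Union) (auto simp: disjoint_family_on_def F_def)
  also have "\<dots> = (\<Sum>m=d+1..CARD('n). \<Sum>J\<in>{J \<in> {J. d < card J}. card J = m}. prob (F J))"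
    by (intro sum.group[symmetric]) (auto simp: card_mono Suc_le_eq)
  also have "\<dots> = (\<Sum>m=d+1..CARD('n). real (CARD('n) choose m) * p ^ m * (1 - p) ^ (CARD('n) - m))"
  proof (intro sum.cong refl)
    fix m assume m: "m \<in> {d+1..CARD('n)}"
    then have "{J \<in> {J. d < card J}. card J = m} = {J :: 'n set. J \<subseteq> UNIV \<and> card J = m}"
      by auto
    then have "card {J \<in> {J :: 'n set. d < card J}. card J = m} = CARD('n) choose m"
      by (simp only: n_subsets[OF finite])
    then show "(\<Sum>J\<in>{J \<in> {J. d < card J}. card J = m}. prob (F J))
        = real (CARD('n) choose m) * p ^ m * (1 - p) ^ (CARD('n) - m)"
      by (simp add: F_prob)
  qed
  finally show ?thesis
    by (simp add: B_def)
qed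

lemma (in prob_space) prob_std_normal_ge_eq_Q:
  assumes "distributed M lborel X std_normal_density"
  shows "prob {\<omega> \<in> space M. x \<le> X \<omega>} = Q x"
proof -
  have "emeasure M (X -` {x..} \<inter> space M)
      = (\<integral>\<^sup>+y. ennreal (std_normal_density y) * indicator {x..} y \<partial>lborel)"
    by (rule distributed_emeasure[OF assms]) simp
  also have "\<dots> = (\<integral>\<^sup>+y. ennreal (indicator {x..} y * std_normal_density y) \<partial>lborel)"
    by (intro nn_integral_cong) (auto simp: indicator_def)
  also have "\<dots> = ennreal (\<integral>y. indicator {x..} y * std_normal_density y \<partial>lborel)"
  proof (rule nn_integral_eq_integral)
    show "integrable lborel (\<lambda>y. indicator {x..} y * std_normal_density y)"
      using integrable_mult_indicator[OF _ integrable_normal_density[of 1 0], of "{x..}"] by simp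
  qed simp
  also have "(\<integral>y. indicator {x..} y * std_normal_density y \<partial>lborel) = Q x"
    by (simp add: Q_def set_lebesgue_integral_def std_normal_density_def)
  finally have "emeasure M (X -` {x..} \<inter> space M) = ennreal (Q x)" .
  moreover have "X -` {x..} \<inter> space M = {\<omega> \<in> space M. x \<le> X \<omega>}"
    by auto
  moreover have "0 \<le> Q x"
    by (auto simp: Q_def set_lebesgue_integral_def intro!: Bochner_Integration.integral_nonneg)
  ultimately show ?thesis
    by (simp add: measure_def)
qed

text \<open>Scaling by \<open>- 1 / \<sigma>\<close> or \<open>1 / \<sigma>\<close> makes either
  tail an upper tail of the standard normal law. The lower tail is the probability of a hard error;
  both are compared in \<open>Q_le_half\<close>.\<close>

lemma (in prob_space) prob_centred_normal_tails:
  assumes X: "distributed M lborel X (normal_density 0 \<sigma>)" and "\<sigma> > 0"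
  shows "prob {\<omega> \<in> space M. X \<omega> \<le> - a} = Q (a / \<sigma>)"
    and "prob {\<omega> \<in> space M. a \<le> X \<omega>} = Q (a / \<sigma>)"
proof -
  have "distributed M lborel (\<lambda>\<omega>. 0 + (- 1 / \<sigma>) * X \<omega>) std_normal_density"
    using normal_density_affine[OF X, of "- 1 / \<sigma>" 0] \<open>\<sigma> > 0\<close> by simp
  from prob_std_normal_ge_eq_Q[OF this, of "a / \<sigma>"]
  show "prob {\<omega> \<in> space M. X \<omega> \<le> - a} = Q (a / \<sigma>)"
    using \<open>\<sigma> > 0\<close> by (simp add: divide_simps le_minus_iff)
  have "distributed M lborel (\<lambda>\<omega>. 0 + (1 / \<sigma>) * X \<omega>) std_normal_density"
    using normal_density_affine[OF X, of "1 / \<sigma>" 0] \<open>\<sigma> > 0\<close> by simp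
  from prob_std_normal_ge_eq_Q[OF this, of "a / \<sigma>"]
  show "prob {\<omega> \<in> space M. a \<le> X \<omega>} = Q (a / \<sigma>)"
    using \<open>\<sigma> > 0\<close> by (simp add: divide_simps)
qed

text \<open>The two tails are disjoint and equally likely. The resulting bound keeps the hard-error
  probability away from 1, as the strict inequality of the theorem requires.\<close>

lemma (in prob_space) Q_le_half:
  assumes X: "distributed M lborel X (normal_density 0 \<sigma>)" and "\<sigma> > 0" "a > 0"
  shows "Q (a / \<sigma>) \<le> 1 / 2"
proof -
  have [measurable]: "X \<in> borel_measurable M"
    using distributed_measurable[OF X] by simp
  have "2 * Q (a / \<sigma>) = prob {\<omega> \<in> space M. X \<omega> \<le> - a} + prob {\<omega> \<in> space M. a \<le> X \<omega>}"
    by (simp add: prob_centred_normal_tails[OF X \<open>\<sigma> > 0\<close>])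
  also have "\<dots> = prob ({\<omega> \<in> space M. X \<omega> \<le> - a} \<union> {\<omega> \<in> space M. a \<le> X \<omega>})"
    using \<open>a > 0\<close> by (intro finite_measure_Union[symmetric]) auto
  also have "\<dots> \<le> 1"
    by (rule prob_le_1)
  finally show ?thesis
    by simp
qed

section \<open>The list decoder\<close>

text \<open>Where \<open>c\<close> and \<open>c'\<close> differ, the two flips of \<open>x\<close>
  have opposite entries, so at least one is nonpositive. Thus two words within distance
  \<open>d\<close> of the hard decision differ in at most \<open>2 * d\<close> places.\<close>

lemma hamming_weight_add_le:
  "hamming_weight (c + c') \<le> card {t. flip c x $ t \<le> 0} + card {t. flip c' x $ t \<le> 0}"
proof -
  have "{t. (c + c') $ t \<noteq> 0} \<subseteq> {t. flip c x $ t \<le> 0} \<union> {t. flip c' x $ t \<le> 0}"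
  proof
    fix t assume "t \<in> {t. (c + c') $ t \<noteq> 0}"
    then show "t \<in> {t. flip c x $ t \<le> 0} \<union> {t. flip c' x $ t \<le> 0}"
      by (cases "c $ t"; cases "c' $ t") (auto simp: flip_def bpsk_def)
  qed
  then have "hamming_weight (c + c') \<le> card ({t. flip c x $ t \<le> 0} \<union> {t. flip c' x $ t \<le> 0})"
    unfolding hamming_weight_def by (intro card_mono) auto
  also have "\<dots> \<le> card {t. flip c x $ t \<le> 0} + card {t. flip c' x $ t \<le> 0}"
    by (rule card_Un_le)
  finally show ?thesis .
qed

text \<open>
  On this region the list decoder with radius \<open>d\<close> decides for the zero codeword. A coordinate
  \<open>y $ t = 0\<close> is counted as a hard error under both signs; this keeps
  \<open>hamming_weight_add_le\<close> valid without exceptions.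
\<close>

definition list_region :: "(bit ^ 'n) set \<Rightarrow> nat \<Rightarrow> (real ^ 'n::finite) set"
  where "list_region C d = {y. card {t. y $ t \<le> 0} \<le> d \<and>
    (\<forall>c\<in>C. hamming_weight c \<le> 2 * d \<longrightarrow> dist (bpsk 0) y \<le> dist (bpsk c) y)}"

lemma list_region_borel [measurable]: "list_region C d \<in> sets borel"
proof -
  \<comment> \<open>Naming the set \<open>J\<close> of hard errors replaces the cardinality by a
    finite disjunction of coordinate conditions, which \<open>measurable\<close> can treat.\<close>
  have "list_region C d = {y. (\<exists>J. card J \<le> d \<and> (\<forall>t. y $ t \<le> 0 \<longleftrightarrow> t \<in> J)) \<and>
      (\<forall>c\<in>C. hamming_weight c \<le> 2 * d \<longrightarrow> dist (bpsk 0) y \<le> dist (bpsk c) y)}"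
    by (auto simp: list_region_def)
  also have "\<dots> \<in> sets borel"
    by measurable
  finally show ?thesis .
qed

text \<open>The sum of the two codewords has weight at most \<open>2 * d\<close>, so it is on the
  list at both flips of \<open>x\<close>. The two comparisons with 0 make both words equally near to
  \<open>x\<close>, and ties are excluded.\<close>

lemma flip_list_region_unique:
  assumes C: "vec.subspace C" "c \<in> C" "c' \<in> C"
    and x: "flip c x \<in> list_region C d" "flip c' x \<in> list_region C d"
    and inj: "inj (\<lambda>c. dist (bpsk c) x)"
  shows "c = c'"
proof -
  have le: "dist (bpsk a) x \<le> dist (bpsk b) x"
    if "a \<in> C" "b \<in> C" "flip a x \<in> list_region C d" "flip b x \<in> list_region C d" for a b
  proof -
    have "a + b \<in> C"
      using C(1) that by (simp add: vec.subspace_add)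
    moreover have "hamming_weight (a + b) \<le> 2 * d"
      using hamming_weight_add_le[of a b x] that by (simp add: list_region_def)
    ultimately have "dist (bpsk 0) (flip a x) \<le> dist (bpsk (a + b)) (flip a x)"
      using that by (simp add: list_region_def)
    \<comment> \<open>Characteristic 2; \<open>dist_bpsk_flip\<close> produces this sum when the
      flip by \<open>a\<close> is undone.\<close>
    moreover have "a + (a + b) = b"
      by (simp add: vec_eq_iff flip: add.assoc)
    ultimately show ?thesis
      by (simp add: dist_bpsk_flip)
  qed
  have "dist (bpsk c) x = dist (bpsk c') x"
    using le[of c c'] le[of c' c] C x by simp
  then show ?thesis
    by (rule injD[OF inj])
qed

section \<open>Optimality of ML decoding\<close>

text \<open>If the flipped point were decoded to \<open>l\<close>, then \<open>k + l\<close> would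
  be as near to \<open>x\<close> as the decision \<open>k\<close>; without ties this forces
  \<open>l\<close> to be 0.\<close>

lemma ml_decoder_flip:
  assumes "vec.subspace C" "ml_decoder C dec" and inj: "inj (\<lambda>c. dist (bpsk c) x)"
  shows "dec (flip (dec x) x) = 0"
proof -
  define k where "k = dec x"
  define l where "l = dec (flip k x)"
  have k: "k \<in> C" "\<And>c. c \<in> C \<Longrightarrow> dist (bpsk k) x \<le> dist (bpsk c) x"
    using assms(2) by (auto simp: ml_decoder_def is_arg_min_linorder k_def)
  have l: "l \<in> C" "\<And>c. c \<in> C \<Longrightarrow> dist (bpsk l) (flip k x) \<le> dist (bpsk c) (flip k x)"
    using assms(2) by (auto simp: ml_decoder_def is_arg_min_linorder l_def)
  have "dist (bpsk (k + l)) x \<le> dist (bpsk k) x"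
    using l(2)[of 0] assms(1) by (simp add: dist_bpsk_flip vec.subspace_0)
  moreover have "dist (bpsk k) x \<le> dist (bpsk (k + l)) x"
    using k l(1) assms(1) by (simp add: vec.subspace_add)
  ultimately have "k + l = k"
    using injD[OF inj, of "k + l" k] by simp
  then show ?thesis
    by (simp add: l_def k_def)
qed

lemma nn_integral_lborel_flip:
  assumes "g \<in> borel_measurable borel"
  shows "(\<integral>\<^sup>+x. g (flip c x) \<partial>lborel) = (\<integral>\<^sup>+x. g x \<partial>lborel)"
proof -
  have "(\<integral>\<^sup>+x. g x \<partial>lborel) = (\<integral>\<^sup>+x. g x \<partial>distr lborel borel (flip c))"
    by (simp add: distr_lborel_flip)
  also have "\<dots> = (\<integral>\<^sup>+x. g (flip c x) \<partial>lborel)"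
    using assms by (intro nn_integral_distr) auto
  finally show ?thesis ..
qed

text \<open>The comparison is not pointwise: \<open>list_region C d\<close> can contain points that
  ML decoding gets wrong, through codewords of weight above \<open>2 * d\<close>. Only the sums over
  the flips of a point are comparable.\<close>

lemma ml_optimal:
  fixes C :: "(bit ^ 'n::finite) set" and f :: "real ^ 'n \<Rightarrow> ennreal"
  assumes C: "vec.subspace C" and dec: "ml_decoder C dec"
    and f [measurable]: "f \<in> borel_measurable borel"
    and f_mono: "\<And>x y. dist (bpsk 0) x \<le> dist (bpsk 0) y \<Longrightarrow> f y \<le> f x"
  shows "emeasure (density lborel f) (list_region C d) \<le> emeasure (density lborel f) {y. dec y = 0}"
proof -
  let ?S = "list_region C d" and ?Z = "{y. dec y = 0}"
  have "dec \<in> borel \<rightarrow>\<^sub>M count_space UNIV"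
    using dec by (simp add: ml_decoder_def)
  from measurable_sets[OF this, of "{0}"] have [measurable]: "?Z \<in> sets borel"
    by (simp add: vimage_def)
  \<comment> \<open>Each \<open>flip c\<close> preserves \<open>lborel\<close>, so every codeword
    contributes the same integral.\<close>
  have orbit: "of_nat (card C) * emeasure (density lborel f) R
      = (\<integral>\<^sup>+x. (\<Sum>c\<in>C. f (flip c x) * indicator R (flip c x)) \<partial>lborel)"
    if [measurable]: "R \<in> sets borel" for R
  proof -
    have "(\<integral>\<^sup>+x. (\<Sum>c\<in>C. f (flip c x) * indicator R (flip c x)) \<partial>lborel)
        = (\<Sum>c\<in>C. \<integral>\<^sup>+x. f (flip c x) * indicator R (flip c x) \<partial>lborel)"
      by (intro nn_integral_sum) measurable
    also have "\<dots> = (\<Sum>c\<in>C. \<integral>\<^sup>+x. f x * indicator R x \<partial>lborel)"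
      by (intro sum.cong refl nn_integral_lborel_flip) measurable
    finally show ?thesis
      by (simp add: emeasure_density)
  qed
  have le: "(\<Sum>c\<in>C. f (flip c x) * indicator ?S (flip c x))
      \<le> (\<Sum>c\<in>C. f (flip c x) * indicator ?Z (flip c x))"
    if inj: "inj (\<lambda>c. dist (bpsk c) x)" for x
  proof (cases "\<exists>c\<in>C. flip c x \<in> ?S")
    case True
    then obtain c where c: "c \<in> C" "flip c x \<in> ?S"
      by blast
    have k: "dec x \<in> C" "dist (bpsk (dec x)) x \<le> dist (bpsk c) x"
      using dec c(1) by (auto simp: ml_decoder_def is_arg_min_linorder)
    have only_c: "flip a x \<in> ?S \<longleftrightarrow> a = c" if "a \<in> C" for a
      using flip_list_region_unique[OF C that c(1) _ c(2) inj] c(2) by blast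
    have "(\<Sum>a\<in>C. f (flip a x) * indicator ?S (flip a x)) = (\<Sum>a\<in>C. if a = c then f (flip c x) else 0)"
      by (intro sum.cong refl) (simp add: indicator_def only_c)
    also have "\<dots> = f (flip c x)"
      using c(1) by simp
    also have "\<dots> \<le> f (flip (dec x) x)"
      using k(2) by (intro f_mono) (simp add: dist_bpsk_flip)
    also have "\<dots> = f (flip (dec x) x) * indicator ?Z (flip (dec x) x)"
      using ml_decoder_flip[OF C dec inj] by simp
    also have "\<dots> \<le> (\<Sum>c\<in>C. f (flip c x) * indicator ?Z (flip c x))"
      using k(1) by (intro member_le_sum) auto
    finally show ?thesis .
  next
    case False
    then have "(\<Sum>c\<in>C. f (flip c x) * indicator ?S (flip c x)) = 0"
      by (intro sum.neutral) auto
    then show ?thesis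
      by simp
  qed
  have "of_nat (card C) * emeasure (density lborel f) ?S \<le> of_nat (card C) * emeasure (density lborel f) ?Z"
    unfolding orbit[OF list_region_borel] orbit[OF \<open>?Z \<in> sets borel\<close>]
    by (intro nn_integral_mono_AE eventually_mono[OF AE_inj_dist_bpsk le])
  \<comment> \<open>Cancelling the factor in \<open>ennreal\<close> requires it to be nonzero and
    finite.\<close>
  moreover have "card C \<noteq> 0"
    using vec.subspace_0[OF C] by auto
  ultimately show ?thesis
    by (subst (asm) ennreal_mult_le_mult_iff) auto
qed

section \<open>The bound for a fixed radius, and its minimum\<close>

text \<open>The binomial theorem for \<open>p + (1 - p)\<close>, with the term for 0 split
  off.\<close>

lemma B_from_one:
  "B p n 1 n = 1 - (1 - p) ^ n"
proof -
  have "1 = (\<Sum>m\<in>{0..n}. real (n choose m) * p ^ m * (1 - p) ^ (n - m))"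
    using binomial_ring[of p "1 - p" n] by (simp add: atLeast0AtMost)
  also have "\<dots> = (1 - p) ^ n + B p n 1 n"
    by (simp add: B_def sum.atLeast_Suc_atMost)
  finally show ?thesis
    by simp
qed

lemma ml_error_prob_le:
  fixes C :: "(bit ^ 'n::finite) set" and z :: "'n \<Rightarrow> 'a \<Rightarrow> real"
  assumes C: "vec.subspace C" and "\<sigma> > 0" and noise: "awgn_noise M \<sigma> z" and dec: "ml_decoder C dec"
  shows "measure M (error_event M z dec) \<le> measure M (\<Union>w\<in>{1..2 * d}. weight_event M z C w)
    + B (Q (1 / \<sigma>)) CARD('n) (d + 1) CARD('n)"
proof -
  interpret prob_space M
    using noise by (simp add: awgn_noise_def)
  have indep: "indep_vars (\<lambda>_. borel) z UNIV"
    and z: "\<And>t. distributed M lborel (z t) (normal_density 0 \<sigma>)"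
    using noise by (auto simp: awgn_noise_def)
  have z_meas [measurable]: "z t \<in> borel_measurable M" for t
    using distributed_measurable[OF z[of t]] by simp
  define Y where "Y = received z"
  have Y_eq: "Y = (\<lambda>\<omega>. \<chi> t. 1 + z t \<omega>)"
    by (auto simp: Y_def received_def bpsk_def vec_eq_iff)
  have Y [measurable]: "Y \<in> borel_measurable M"
    unfolding Y_eq by measurable
  define f where "f y = (\<Prod>t\<in>UNIV. ennreal (normal_density 1 \<sigma> (y $ t)))" for y :: "real ^ 'n"
  have f_meas: "f \<in> borel_measurable borel"
    unfolding f_def by measurable
  have f_eq: "f y = ennreal ((1 / sqrt (2 * pi * \<sigma>\<^sup>2)) ^ CARD('n) * exp (- (dist (bpsk 0) y)\<^sup>2 / (2 * \<sigma>\<^sup>2)))" for y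
    using prod_normal_density_cart[OF \<open>\<sigma> > 0\<close>, of "bpsk 0" y]
    by (simp add: f_def prod_ennreal bpsk_def)
  have f_mono: "f y \<le> f x" if "dist (bpsk 0) x \<le> dist (bpsk 0) y" for x y
    unfolding f_eq using that
    by (intro ennreal_leI mult_left_mono) (auto intro!: divide_right_mono power_mono)
  have distr_Y: "distr M borel Y = density lborel f"
  proof -
    have "indep_vars (\<lambda>_. borel) (\<lambda>t \<omega>. 1 + z t \<omega>) UNIV"
      by (rule indep_vars_compose2[OF indep]) auto
    moreover have "distributed M lborel (\<lambda>\<omega>. 1 + z t \<omega>) (normal_density 1 \<sigma>)" for t
      using normal_density_affine[OF z \<open>\<sigma> > 0\<close>, of 1 1 t] by simp
    ultimately show ?thesis
      unfolding Y_eq f_def by (rule distr_vec_density)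
  qed
  have emeasure_Y: "emeasure M {\<omega> \<in> space M. Y \<omega> \<in> R} = emeasure (density lborel f) R"
    if "R \<in> sets borel" for R
    using emeasure_distr[OF Y that] by (simp add: distr_Y vimage_def Int_def conj_commute)
  have "dec \<in> borel \<rightarrow>\<^sub>M count_space UNIV"
    using dec by (simp add: ml_decoder_def)
  from measurable_sets[OF this, of "{0}"] have correct [measurable]: "{y. dec y = 0} \<in> sets borel"
    by (simp add: vimage_def)
  have "emeasure M {\<omega> \<in> space M. Y \<omega> \<in> list_region C d} \<le> emeasure M {\<omega> \<in> space M. Y \<omega> \<in> {y. dec y = 0}}"
    unfolding emeasure_Y[OF list_region_borel] emeasure_Y[OF correct]
    by (rule ml_optimal[OF C dec f_meas f_mono])
  then have opt: "prob {\<omega> \<in> space M. Y \<omega> \<in> list_region C d} \<le> prob {\<omega> \<in> space M. Y \<omega> \<in> {y. dec y = 0}}"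
    by (simp add: emeasure_eq_measure)
  \<comment> \<open>As \<open>bpsk 0\<close> is the all-one vector, a hard error at \<open>t\<close>
    means that \<open>z t \<omega>\<close> is at most -1; this is where
    \<open>Q (1 / \<sigma>)\<close> comes from.\<close>
  define H where "H = {\<omega> \<in> space M. d < card {t. z t \<omega> \<in> {..-1}}}"
  define W where "W = (\<Union>w\<in>{1..2 * d}. weight_event M z C w)"
  have W [measurable]: "W \<in> events"
    unfolding W_def weight_event_def Y_def[symmetric] by measurable
  have H_eq: "H = (\<Union>J\<in>{J. d < card J}. {\<omega> \<in> space M. \<forall>t. z t \<omega> \<le> -1 \<longleftrightarrow> t \<in> J})"
    by (auto simp: H_def)
  have H [measurable]: "H \<in> events"
    unfolding H_eq by measurable
  have "error_event M z dec = space M - {\<omega> \<in> space M. Y \<omega> \<in> {y. dec y = 0}}"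
    by (auto simp: error_event_def Y_def)
  moreover have "{\<omega> \<in> space M. Y \<omega> \<in> {y. dec y = 0}} \<in> events"
    by measurable
  ultimately have "prob (error_event M z dec) = 1 - prob {\<omega> \<in> space M. Y \<omega> \<in> {y. dec y = 0}}"
    using prob_compl by metis
  also have "\<dots> \<le> 1 - prob {\<omega> \<in> space M. Y \<omega> \<in> list_region C d}"
    using opt by simp
  also have "\<dots> = prob (space M - {\<omega> \<in> space M. Y \<omega> \<in> list_region C d})"
    by (rule prob_compl[symmetric]) measurable
  also have "\<dots> \<le> prob (W \<union> H)"
  proof (rule finite_measure_mono)
    show "space M - {\<omega> \<in> space M. Y \<omega> \<in> list_region C d} \<subseteq> W \<union> H"
    proof
      fix \<omega> assume \<omega>: "\<omega> \<in> space M - {\<omega> \<in> space M. Y \<omega> \<in> list_region C d}"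
      show "\<omega> \<in> W \<union> H"
      proof (cases "\<omega> \<in> H")
        case False
        have "{t. Y \<omega> $ t \<le> 0} = {t. z t \<omega> \<le> -1}"
          by (auto simp: Y_eq)
        then have "card {t. Y \<omega> $ t \<le> 0} \<le> d"
          using False \<omega> by (simp add: H_def)
        then obtain c where c: "c \<in> C" "hamming_weight c \<le> 2 * d" "dist (bpsk c) (Y \<omega>) < dist (bpsk 0) (Y \<omega>)"
          using \<omega> by (auto simp: list_region_def not_le)
        \<comment> \<open>The union \<open>W\<close> starts at weight 1, so the zero word has to be
          excluded.\<close>
        then have "c \<noteq> 0"
          by auto
        then have "hamming_weight c \<noteq> 0"
          by (auto simp: hamming_weight_def vec_eq_iff)
        then show ?thesis
          using c \<omega> by (auto simp: W_def weight_event_def Y_def Suc_le_eq)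
      qed simp
    qed
  qed measurable
  also have "\<dots> \<le> prob W + prob H"
    by (rule measure_Un_le) measurable
  also have "prob H = B (Q (1 / \<sigma>)) CARD('n) (d + 1) CARD('n)"
    unfolding H_def using prob_centred_normal_tails(1)[OF z \<open>\<sigma> > 0\<close>, of _ 1]
    by (intro prob_card_eq_binomial_tail[OF indep]) auto
  finally show ?thesis
    by (simp add: W_def)
qed

theorem proposition1:
  fixes C :: "(bit ^ 'n::finite) set"
    and \<sigma> :: real
    and M :: "'a measure"
    and z :: "'n \<Rightarrow> 'a \<Rightarrow> real"
    and dec :: "real ^ 'n \<Rightarrow> bit ^ 'n"
    and T :: "(bit ^ 'n) set \<Rightarrow> real"
  defines "rhs \<equiv> Min ((\<lambda>d. T (subcode C (2 * d)) + B (Q (1 / \<sigma>)) CARD('n) (d + 1) CARD('n)) ` {0..CARD('n)})"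
  assumes "vec.subspace C"
    and "\<sigma> > 0"
    and "awgn_noise M \<sigma> z"
    and "ml_decoder C dec"
    and "upper_bounding_technique M z C T"
  shows "measure M (error_event M z dec) \<le> rhs \<and> rhs < 1 \<and> rhs \<le> T C"
proof -
  interpret prob_space M
    using \<open>awgn_noise M \<sigma> z\<close> by (simp add: awgn_noise_def)
  let ?p = "Q (1 / \<sigma>)" and ?n = "CARD('n)"
  let ?F = "\<lambda>d. T (subcode C (2 * d)) + B ?p ?n (d + 1) ?n"
  have T: "T (subcode C 0) = 0" "measure M (\<Union>w\<in>{1..t}. weight_event M z C w) \<le> T (subcode C t)" for t
    using \<open>upper_bounding_technique M z C T\<close> by (auto simp: upper_bounding_technique_def)
  have "measure M (error_event M z dec) \<le> ?F d" for d
    using ml_error_prob_le[OF \<open>vec.subspace C\<close> \<open>\<sigma> > 0\<close> \<open>awgn_noise M \<sigma> z\<close> \<open>ml_decoder C dec\<close>, of d] T(2)[of "2 * d"]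
    by linarith
  then have bound: "measure M (error_event M z dec) \<le> rhs"
    unfolding rhs_def by (intro Min.boundedI) auto
  have rhs_le: "rhs \<le> ?F d" if "d \<le> ?n" for d
    unfolding rhs_def using that by (intro Min_le) auto
  \<comment> \<open>Any noise coordinate serves as the normal variable; \<open>undefined\<close>
    names one index.\<close>
  have "?p \<le> 1 / 2"
    using Q_le_half[of "z undefined" \<sigma> 1] assms(3,4) by (simp add: awgn_noise_def)
  \<comment> \<open>At radius 0 the value is \<open>1 - (1 - ?p) ^ ?n\<close>, and
    \<open>1 - ?p\<close> is positive.\<close>
  then have "?F 0 < 1"
    using T(1) B_from_one[of ?p ?n] by simp
  then have "rhs < 1"
    using rhs_le[of 0] by linarith
  moreover have "hamming_weight c \<le> 2 * ?n" for c :: "bit ^ 'n"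
    using card_mono[OF finite subset_UNIV, of "{t. c $ t \<noteq> 0}"] by (simp add: hamming_weight_def)
  \<comment> \<open>At radius \<open>?n\<close> the sub-code is all of \<open>C\<close>, and the
    tail from \<open>?n + 1\<close> to \<open>?n\<close> is an empty sum.\<close>
  then have "?F ?n = T C"
    by (simp add: subcode_def B_def)
  then have "rhs \<le> T C"
    using rhs_le[of ?n] by simp
  ultimately show ?thesis
    using bound by simp
qed

end
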